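(* The space of real parametrizations of rational curves of degree $6$ in $\mathbb{RP}^4$ that lie in the sphere $S^3$ is a manifold of dimension $21$ (i.e. of codimension $13$ in the space $\mathbb{RP}^{34}$ of all $5$-tuples of coefficients).
   Context: $S^3$ denotes the real quadric $x_1^2+x_2^2+x_3^2+x_4^2=x_0^2$ in $\mathbb{RP}^4$. A real parametrization of a rational curve of degree $6$ in $\mathbb{RP}^4$ is a map $[p_0:p_1:p_2:p_3:p_4]:\mathbb{RP}^1\to\mathbb{RP}^4$, where $p_0,\dots,p_4$ are real homogeneous polynomials of degree $6$ in two variables without common (complex) root; such $5$-tuples, up to a common nonzero real factor, are regarded as points of $\mathbb{RP}^{34}$ via their $35$ coefficients. The curve lies in the sphere if $p_1^2+p_2^2+p_3^2+p_4^2-p_0^2=0$ identically. *)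

theory Defs
  imports "HOL-Analysis.Analysis"
begin

primrec Ck_on :: "nat \<Rightarrow> 'a::real_normed_vector set \<Rightarrow> ('a \<Rightarrow> 'b::real_normed_vector) \<Rightarrow> bool" where
  "Ck_on 0 U f \<longleftrightarrow> continuous_on U f"
| "Ck_on (Suc k) U f \<longleftrightarrow> (\<forall>x\<in>U. f differentiable (at x)) \<and>
     (\<forall>v. Ck_on k U (\<lambda>x. frechet_derivative f (at x) v))"

(* Only meant for open U in a finite-dimensional space, where directional derivatives suffice. *)
definition smooth_on :: "'a::euclidean_space set \<Rightarrow> ('a \<Rightarrow> 'b::euclidean_space) \<Rightarrow> bool" where
  "smooth_on U f \<longleftrightarrow> (\<forall>k. Ck_on k U f)"

definition diffeomorphism ::
  "'a::euclidean_space set \<Rightarrow> 'b::euclidean_space set \<Rightarrow> ('a \<Rightarrow> 'b) \<Rightarrow> ('b \<Rightarrow> 'a) \<Rightarrow> bool" where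
  "diffeomorphism U V f g \<longleftrightarrow>
     open U \<and> open V \<and> homeomorphism U V f g \<and> smooth_on U f \<and> smooth_on V g"

(* Embedded d-dimensional C^infinity submanifold of a Euclidean space (local slice condition). *)
definition smooth_submanifold :: "nat \<Rightarrow> 'a::euclidean_space set \<Rightarrow> bool" where
  "smooth_submanifold d S \<longleftrightarrow>
     (\<forall>x\<in>S. \<exists>U V (f :: 'a \<Rightarrow> 'a) g W. x \<in> U \<and> diffeomorphism U V f g \<and>
        subspace W \<and> dim W = d \<and> f ` (S \<inter> U) = W \<inter> V)"

(* Points of the real projectivization of a vector space: nonzero vectors up to nonzero factors. *)
definition proj_class :: "'v::real_vector \<Rightarrow> 'v set" where
  "proj_class v = {c *\<^sub>R v | c. c \<noteq> 0}"

definition proj_space :: "'v::real_vector set set" where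
  "proj_space = proj_class ` (- {0})"

(* When DIM('v) = DIM('m) + 1, these are the inverses of all affine charts of the projective
   space of 'v, with model space 'm: the image of such a map is the complement of the hyperplane
   "range L" at infinity. They are an atlas of the standard smooth structure; the coordinate
   charts arise by letting a and L range over coordinate vectors and coordinate embeddings. *)
definition affine_charts :: "('m::euclidean_space \<Rightarrow> 'v::euclidean_space set) set" where
  "affine_charts =
     {\<lambda>x. proj_class (a + L x) | a L. linear L \<and> inj L \<and> a \<notin> range L}"

(* A is an atlas of a manifold X, given by (globally defined) inverse charts. The first two
   conditions make sure that A has enough charts for the last one to be meaningful. *)
definition submanifold_in :: "('m::euclidean_space \<Rightarrow> 'p) set \<Rightarrow> 'p set \<Rightarrow> nat \<Rightarrow> 'p set \<Rightarrow> bool" where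
  "submanifold_in A X d M \<longleftrightarrow>
     X = (\<Union>\<psi>\<in>A. range \<psi>) \<and> M \<subseteq> X \<and> (\<forall>\<psi>\<in>A. smooth_submanifold d (\<psi> -` M))"

(* p $ i is the i-th form (i = 0, ..., 4), and p $ i $ j the coefficient of s^j t^(6-j) in it. *)
type_synonym coeffs = "real^7^5"

definition sextic :: "real^7 \<Rightarrow> 'a::{real_algebra_1,comm_ring_1} \<Rightarrow> 'a \<Rightarrow> 'a" where
  "sextic c s t = (\<Sum>j\<le>6. of_real (c $ of_nat j) * s ^ j * t ^ (6 - j))"

definition no_common_root :: "coeffs \<Rightarrow> bool" where
  "no_common_root p \<longleftrightarrow>
     \<not> (\<exists>s t :: complex. (s, t) \<noteq> (0, 0) \<and> (\<forall>i. sextic (p $ i) s t = 0))"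

definition in_sphere :: "coeffs \<Rightarrow> bool" where
  "in_sphere p \<longleftrightarrow> (\<forall>s t :: real.
     (sextic (p $ 1) s t)\<^sup>2 + (sextic (p $ 2) s t)\<^sup>2 + (sextic (p $ 3) s t)\<^sup>2
       + (sextic (p $ 4) s t)\<^sup>2 - (sextic (p $ 0) s t)\<^sup>2 = 0)"

definition sphere_parametrizations :: "coeffs set set" where
  "sphere_parametrizations = {proj_class p | p. no_common_root p \<and> in_sphere p}"

end

theory Submission
  imports Defs "HOL-Computational_Algebra.Field_as_Ring"
    "HOL-Computational_Algebra.Polynomial_Factorial"
    "HOL-Computational_Algebra.Fundamental_Theorem_Algebra"
begin

text \<open>
  The sphere condition is the vanishing of the quadratic map \<open>p \<mapsto> pairing p p\<close> into the
  13-dimensional space of forms of degree 12, whose derivative at \<open>p\<close> is \<open>2 * pairing p\<close>.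
  On the sphere \<open>p\<^sub>0\<close> has no zero at infinity unless all \<open>p\<^sub>i\<close> vanish there, so when there is no common
  root, a Bezout relation between the \<open>p\<^sub>i\<close> can be reduced modulo \<open>p\<^sub>0\<close>, which shows that
  \<open>pairing p\<close> is onto. Conversely, surjectivity rules out common roots. The parametrizations
  are thus precisely the regular zeros, and since \<open>pairing p p = 0\<close>, restricting the derivative to
  a hyperplane that does not contain \<open>p\<close> keeps it onto: the same is true in every affine chart.
\<close>

section \<open>Smooth functions and the smooth inverse function theorem\<close>

text \<open>Derivatives at a point depend only on a neighborhood of it, so openness of
  \<open>U\<close> passes the equality on to all directional derivatives.\<close>

lemma Ck_on_cong:
  assumes "open U" "\<And>x. x \<in> U \<Longrightarrow> f x = g x" "Ck_on k U f"
  shows "Ck_on k U g"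
  using assms(2,3)
proof (induction k arbitrary: f g)
  case 0
  then show ?case by (simp cong: continuous_on_cong)
next
  case (Suc k)
  have fg: "frechet_derivative f (at x) = frechet_derivative g (at x)" "g differentiable (at x)"
    if "x \<in> U" for x
  proof -
    have df: "f differentiable (at x)"
      using Suc.prems that by simp
    then show "frechet_derivative f (at x) = frechet_derivative g (at x)"
      using frechet_derivative_transform_within_open[OF _ \<open>open U\<close> that] Suc.prems by blast
    show "g differentiable (at x)"
      using df has_derivative_transform_within_open[OF _ \<open>open U\<close> that] Suc.prems
      unfolding differentiable_def by blast
  qed
  moreover have "Ck_on k U (\<lambda>x. frechet_derivative g (at x) v)" for v
    using Suc.IH[of "\<lambda>x. frechet_derivative f (at x) v" "\<lambda>x. frechet_derivative g (at x) v"]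
      Suc.prems fg by simp
  ultimately show ?case by simp
qed

text \<open>Lets an explicit derivative formula \<open>f'\<close> replace the choice operator behind
  \<open>frechet_derivative\<close>; both agree on \<open>U\<close> because derivatives are
  unique.\<close>

lemma Ck_on_SucI:
  assumes "open U" "\<And>x. x \<in> U \<Longrightarrow> (f has_derivative f' x) (at x)"
    "\<And>v. Ck_on k U (\<lambda>x. f' x v)"
  shows "Ck_on (Suc k) U f"
proof -
  have "Ck_on k U (\<lambda>x. frechet_derivative f (at x) v)" for v
    by (rule Ck_on_cong[OF \<open>open U\<close> _ assms(3)[of v]])
      (use assms(2) frechet_derivative_at in metis)
  then show ?thesis
    using assms(2) by (auto simp: differentiable_def)
qed

lemma Ck_on_Suc_has_derivative:
  assumes "Ck_on (Suc k) U f" "x \<in> U"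
  shows "(f has_derivative frechet_derivative f (at x)) (at x)"
  using assms frechet_derivative_works by auto

lemma Ck_on_SucD: "Ck_on (Suc k) U f \<Longrightarrow> Ck_on k U f"
proof (induction k arbitrary: f)
  case 0
  then show ?case
    by (auto simp: continuous_on_eq_continuous_within
        intro: differentiable_imp_continuous_within differentiable_at_withinI)
next
  case (Suc k)
  then show ?case
    unfolding Ck_on.simps(2)[of "Suc k" U f] by auto
qed

lemma Ck_on_const: "open U \<Longrightarrow> Ck_on k U (\<lambda>x. c)"
proof (induction k arbitrary: c)
  case (Suc k)
  then show ?case by (intro Ck_on_SucI[where f' = "\<lambda>x v. 0"]) auto
qed simp

lemma Ck_on_bounded_linear:
  assumes "open U" "bounded_linear h"
  shows "Ck_on k U h"
proof (cases k)
  case 0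
  then show ?thesis using assms by (simp add: linear_continuous_on)
next
  case (Suc k)
  then show ?thesis
    using assms Ck_on_SucI[where f' = "\<lambda>x. h"] Ck_on_const bounded_linear_imp_has_derivative
    by blast
qed

lemma Ck_on_bounded_linear_comp:
  assumes "open U" "bounded_linear h" "Ck_on k U f"
  shows "Ck_on k U (\<lambda>x. h (f x))"
  using assms(3)
proof (induction k arbitrary: f)
  case 0
  then show ?case by (simp add: bounded_linear.continuous_on[OF assms(2)])
next
  case (Suc k)
  show ?case
  proof (rule Ck_on_SucI[OF \<open>open U\<close>])
    show "((\<lambda>x. h (f x)) has_derivative (\<lambda>v. h (frechet_derivative f (at x) v))) (at x)"
      if "x \<in> U" for x
      using bounded_linear.has_derivative[OF assms(2)] Ck_on_Suc_has_derivative[OF Suc.prems that]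
      by blast
    show "Ck_on k U (\<lambda>x. h (frechet_derivative f (at x) v))" for v
      using Suc by simp
  qed
qed

lemma Ck_on_add:
  assumes "open U" "Ck_on k U f" "Ck_on k U g"
  shows "Ck_on k U (\<lambda>x. f x + g x)"
  using assms(2,3)
proof (induction k arbitrary: f g)
  case 0
  then show ?case by (simp add: continuous_on_add)
next
  case (Suc k)
  show ?case
  proof (rule Ck_on_SucI[OF \<open>open U\<close>])
    show "((\<lambda>x. f x + g x) has_derivative
        (\<lambda>v. frechet_derivative f (at x) v + frechet_derivative g (at x) v)) (at x)" if "x \<in> U" for x
      using Ck_on_Suc_has_derivative that Suc.prems by (intro has_derivative_add) blast+
  qed (use Suc in simp)
qed

lemma Ck_on_sum:
  assumes "open U" "\<And>i. i \<in> I \<Longrightarrow> Ck_on k U (f i)"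
  shows "Ck_on k U (\<lambda>x. \<Sum>i\<in>I. f i x)"
  using assms(2)
  by (induction I rule: infinite_finite_induct) (auto simp: Ck_on_const Ck_on_add \<open>open U\<close>)

text \<open>By the Leibniz rule the derivative involves \<open>f\<close> and \<open>g\<close>
  themselves next to their derivatives; \<open>Ck_on_SucD\<close> supplies them at the lower order
  that the induction needs.\<close>

lemma (in bounded_bilinear) Ck_on_bilinear:
  assumes "open U" "Ck_on k U f" "Ck_on k U g"
  shows "Ck_on k U (\<lambda>x. prod (f x) (g x))"
  using assms(2,3)
proof (induction k arbitrary: f g)
  case 0
  then show ?case by (simp add: continuous_on)
next
  case (Suc k)
  have "Ck_on k U f" "Ck_on k U g"
    using Suc.prems by (blast dest: Ck_on_SucD)+
  show ?case
  proof (rule Ck_on_SucI[OF \<open>open U\<close>])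
    show "((\<lambda>x. prod (f x) (g x)) has_derivative
        (\<lambda>v. prod (f x) (frechet_derivative g (at x) v) + prod (frechet_derivative f (at x) v) (g x))) (at x)"
      if "x \<in> U" for x
      using Suc.prems by (intro FDERIV Ck_on_Suc_has_derivative[OF _ that])
  qed (use Suc \<open>Ck_on k U f\<close> \<open>Ck_on k U g\<close> in \<open>simp add: Ck_on_add[OF \<open>open U\<close>]\<close>)
qed

lemmas Ck_on_mult = bounded_bilinear.Ck_on_bilinear[OF bounded_bilinear_mult]
lemmas Ck_on_scaleR = bounded_bilinear.Ck_on_bilinear[OF bounded_bilinear_scaleR]

lemma Ck_on_prod:
  fixes f :: "'i \<Rightarrow> 'a::real_normed_vector \<Rightarrow> 'b::real_normed_field"
  assumes "open U" "\<And>i. i \<in> I \<Longrightarrow> Ck_on k U (f i)"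
  shows "Ck_on k U (\<lambda>x. \<Prod>i\<in>I. f i x)"
  using assms(2)
  by (induction I rule: infinite_finite_induct) (auto simp: Ck_on_const Ck_on_mult \<open>open U\<close>)

text \<open>The derivative of the reciprocal is a product of the reciprocal itself, known to be one
  order less smooth, and the derivative of \<open>f\<close>.\<close>

lemma Ck_on_inverse:
  fixes f :: "'a::real_normed_vector \<Rightarrow> 'b::real_normed_field"
  assumes "open U" "Ck_on k U f" "\<And>x. x \<in> U \<Longrightarrow> f x \<noteq> 0"
  shows "Ck_on k U (\<lambda>x. inverse (f x))"
  using assms(2)
proof (induction k)
  case 0
  then show ?case by (simp add: continuous_on_inverse assms(3))
next
  case (Suc k)
  then have inv: "Ck_on k U (\<lambda>x. inverse (f x))"
    by (blast dest: Ck_on_SucD)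
  show ?case
  proof (rule Ck_on_SucI[OF \<open>open U\<close>])
    show "((\<lambda>x. inverse (f x)) has_derivative
        (\<lambda>v. - (inverse (f x) * frechet_derivative f (at x) v * inverse (f x)))) (at x)"
      if "x \<in> U" for x
      using Ck_on_Suc_has_derivative that Suc.prems assms(3) by (intro Deriv.has_derivative_inverse) blast+
    show "Ck_on k U (\<lambda>x. - (inverse (f x) * frechet_derivative f (at x) v * inverse (f x)))" for v
      by (intro Ck_on_bounded_linear_comp[OF \<open>open U\<close>, of uminus] Ck_on_mult \<open>open U\<close> inv
          bounded_linear_minus bounded_linear_ident) (use Suc.prems in simp)
  qed
qed

text \<open>In the chain rule both the base point and the direction of the derivative of
  \<open>f\<close> vary with \<open>x\<close>. Expanding the direction in \<open>Basis\<close>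
  separates them: each summand is a scalar function times a derivative of \<open>f\<close> in a
  fixed direction, composed with \<open>g\<close>, to which the induction hypothesis
  applies.\<close>

lemma Ck_on_compose:
  fixes g :: "'a::real_normed_vector \<Rightarrow> 'b::euclidean_space" and f :: "'b \<Rightarrow> 'c::real_normed_vector"
  assumes "open U" "g ` U \<subseteq> V" "Ck_on k V f" "Ck_on k U g"
  shows "Ck_on k U (\<lambda>x. f (g x))"
  using assms(3,4)
proof (induction k arbitrary: f)
  case 0
  then show ?case using continuous_on_compose2 assms(2) by auto
next
  case (Suc k)
  have "Ck_on k U g"
    using Suc.prems by (blast dest: Ck_on_SucD)
  show ?case
  proof (rule Ck_on_SucI[OF \<open>open U\<close>])
    fix x assume x: "x \<in> U"
    have df: "(f has_derivative frechet_derivative f (at (g x))) (at (g x))"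
      using Ck_on_Suc_has_derivative Suc.prems assms(2) x by blast
    have comp: "frechet_derivative f (at (g x)) w = (\<Sum>b\<in>Basis. (w \<bullet> b) *\<^sub>R frechet_derivative f (at (g x)) b)" for w
    proof -
      have lin: "linear (frechet_derivative f (at (g x)))"
        using df has_derivative_linear by blast
      have "frechet_derivative f (at (g x)) (\<Sum>b\<in>Basis. (w \<bullet> b) *\<^sub>R b)
          = (\<Sum>b\<in>Basis. (w \<bullet> b) *\<^sub>R frechet_derivative f (at (g x)) b)"
        by (simp only: linear_sum[OF lin] linear_scale[OF lin])
      then show ?thesis by (simp only: euclidean_representation)
    qed
    show "((\<lambda>x. f (g x)) has_derivative (\<lambda>v. \<Sum>b\<in>Basis.
        (frechet_derivative g (at x) v \<bullet> b) *\<^sub>R frechet_derivative f (at (g x)) b)) (at x)"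
      using has_derivative_compose[OF Ck_on_Suc_has_derivative[OF Suc.prems(2) x] df]
      by (simp only: comp[symmetric])
  next
    show "Ck_on k U (\<lambda>x. \<Sum>b\<in>Basis.
        (frechet_derivative g (at x) v \<bullet> b) *\<^sub>R frechet_derivative f (at (g x)) b)" for v
    proof (intro Ck_on_sum Ck_on_scaleR \<open>open U\<close>)
      fix b :: 'b
      show "Ck_on k U (\<lambda>x. frechet_derivative g (at x) v \<bullet> b)"
        using Suc.prems(2)
        by (intro Ck_on_bounded_linear_comp[OF \<open>open U\<close>, of "\<lambda>w. w \<bullet> b"] bounded_linear_inner_left) simp
      show "Ck_on k U (\<lambda>x. frechet_derivative f (at (g x)) b)"
        using Suc.IH[of "\<lambda>y. frechet_derivative f (at y) b"] Suc.prems(1) \<open>Ck_on k U g\<close> by simp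
    qed
  qed
qed

lemma Ck_on_vec_nth:
  fixes f :: "'a::real_normed_vector \<Rightarrow> real^'n"
  assumes "open U" "Ck_on k U f"
  shows "Ck_on k U (\<lambda>x. f x $ i)"
  using Ck_on_bounded_linear_comp[OF assms(1) _ assms(2), of "\<lambda>w. w $ i"]
  by (simp add: bounded_linear_vec_nth)

lemma Ck_on_vec_lambda:
  fixes f :: "'n::finite \<Rightarrow> 'a::real_normed_vector \<Rightarrow> real"
  assumes "open U" "\<And>i. Ck_on k U (f i)"
  shows "Ck_on k U (\<lambda>x. \<chi> i. f i x)"
proof -
  have "(\<lambda>x. \<chi> i. f i x) = (\<lambda>x. \<Sum>i\<in>UNIV. f i x *\<^sub>R axis i 1)"
    using basis_expansion[of "\<chi> i. f i _"] by (auto simp: scalar_mult_eq_scaleR[symmetric])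
  then show ?thesis
    by (simp add: Ck_on_sum Ck_on_scaleR Ck_on_const assms)
qed

lemma Ck_on_det:
  fixes A :: "'a::real_normed_vector \<Rightarrow> real^'n^'n"
  assumes "open U" "\<And>i j. Ck_on k U (\<lambda>x. A x $ i $ j)"
  shows "Ck_on k U (\<lambda>x. det (A x))"
  unfolding det_def by (intro Ck_on_sum Ck_on_mult Ck_on_prod Ck_on_const assms)

section \<open>Smoothness of local inverses\<close>

text \<open>Bootstrapping: by Cramer's rule the components of \<open>g' y v\<close> are rational
  expressions in the partial derivatives of \<open>f\<close> at \<open>g y\<close>. These are of
  class k as soon as \<open>g\<close> is, which makes \<open>g\<close> of class k + 1.\<close>

lemma Ck_on_inverse_function:
  fixes f :: "real^'n \<Rightarrow> real^'n"
  assumes f: "smooth_on U f" and "open V" and gV: "g ` V \<subseteq> U"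
    and dg: "\<And>y. y \<in> V \<Longrightarrow> (g has_derivative g' y) (at y)"
    and g': "\<And>y. y \<in> V \<Longrightarrow> g' y = inv (frechet_derivative f (at (g y)))"
    and bij: "\<And>y. y \<in> V \<Longrightarrow> bij (frechet_derivative f (at (g y)))"
  shows "Ck_on k V g"
proof (induction k)
  case 0
  have "g differentiable_on V"
    using dg by (auto simp: differentiable_on_def differentiable_def intro: has_derivative_at_withinI)
  then show ?case by (simp add: differentiable_imp_continuous_on)
next
  case (Suc k)
  define A where "A y = matrix (frechet_derivative f (at (g y)))" for y
  have Ck: "Ck_on m U f" for m
    using f by (simp add: smooth_on_def)
  have lin: "linear (frechet_derivative f (at (g y)))" if "y \<in> V" for y
    using Ck_on_Suc_has_derivative[OF Ck] gV that has_derivative_linear by blast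
  have A: "A y *v w = frechet_derivative f (at (g y)) w" if "y \<in> V" for y w
    using matrix_works lin[OF that] by (simp add: A_def linear_matrix_vector_mul_eq)
  have nz: "det (A y) \<noteq> 0" if "y \<in> V" for y
    using det_nz_iff_inj[OF lin[OF that]] bij[OF that] by (simp add: A_def bij_def)
  have "A y *v g' y v = v" if "y \<in> V" for y v
    using bij[OF that] that by (simp add: A g' bij_is_surj surj_f_inv_f)
  then have cr: "g' y v = (\<chi> l. det (\<chi> i j. if j = l then v $ i else A y $ i $ j) / det (A y))"
    if "y \<in> V" for y v
    using cramer[OF nz[OF that]] that by blast
  have CkA: "Ck_on k V (\<lambda>y. A y $ i $ j)" for i j :: 'n
  proof -
    have "Ck_on k V (\<lambda>y. frechet_derivative f (at (g y)) (axis j 1))"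
      using Ck_on_compose[OF \<open>open V\<close> gV _ Suc.IH, of "\<lambda>y. frechet_derivative f (at y) (axis j 1)"]
        Ck[of "Suc k"] by simp
    then show ?thesis
      by (simp add: A_def matrix_def Ck_on_vec_nth \<open>open V\<close>)
  qed
  show ?case
  proof (rule Ck_on_SucI[OF \<open>open V\<close> dg])
    fix v
    have "Ck_on k V (\<lambda>y. \<chi> l. det (\<chi> i j. if j = l then v $ i else A y $ i $ j) / det (A y))"
      unfolding divide_inverse
    proof (intro Ck_on_vec_lambda Ck_on_mult Ck_on_inverse Ck_on_det \<open>open V\<close> CkA nz)
      \<comment> \<open>Cramer's matrix has the constant vector \<open>v\<close> as column
        \<open>l\<close>; its other entries come from \<open>A y\<close>.\<close>
      show "Ck_on k V (\<lambda>y. (\<chi> i j. if j = l then v $ i else A y $ i $ j) $ i $ j)" for i j l :: 'n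
        by (cases "j = l") (simp_all add: Ck_on_const CkA \<open>open V\<close>)
    qed
    then show "Ck_on k V (\<lambda>y. g' y v)"
      by (rule Ck_on_cong[OF \<open>open V\<close>, rotated]) (simp add: cr)
  qed
qed

text \<open>The inverse function theorem for continuously differentiable maps gives \<open>g\<close>
  with derivative inverse to that of \<open>f\<close>; the bootstrapping lemma makes
  \<open>g\<close> smooth. Bijectivity of the derivative on all of \<open>U'\<close> is recorded
  because it later shows that regularity persists near a regular zero.\<close>

theorem smooth_inverse_function:
  fixes f :: "real^'n \<Rightarrow> real^'n"
  assumes "open U" "smooth_on U f" "x0 \<in> U" "inj (frechet_derivative f (at x0))"
  obtains U' V g where "U' \<subseteq> U" "x0 \<in> U'" "diffeomorphism U' V f g"
    "\<And>x. x \<in> U' \<Longrightarrow> bij (frechet_derivative f (at x))"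
proof -
  define f' where "f' x = Blinfun (frechet_derivative f (at x))" for x
  have Ck: "Ck_on k U f" for k
    using assms(2) by (simp add: smooth_on_def)
  have deriv: "(f has_derivative frechet_derivative f (at x)) (at x)" if "x \<in> U" for x
    using Ck_on_Suc_has_derivative[OF Ck that] .
  have f': "blinfun_apply (f' x) = frechet_derivative f (at x)" if "x \<in> U" for x
    using has_derivative_bounded_linear[OF deriv[OF that]]
    by (simp add: f'_def bounded_linear_Blinfun_apply)
  \<comment> \<open>Continuity in the operator norm is required; in finite dimension it follows from
    continuity of each directional derivative.\<close>
  have cont: "continuous_on U f'"
  proof (rule continuous_on_blinfun_componentwise)
    fix i :: "real^'n"
    have "continuous_on U (\<lambda>x. frechet_derivative f (at x) i)"
      using Ck[of "Suc 0"] by simp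
    then show "continuous_on U (\<lambda>x. blinfun_apply (f' x) i)"
      using f' by (simp cong: continuous_on_cong)
  qed
  have lin: "linear (frechet_derivative f (at x0))"
    using deriv assms(3) has_derivative_linear by blast
  obtain h where h: "linear h" "h \<circ> frechet_derivative f (at x0) = id"
    using linear_injective_left_inverse[OF lin assms(4)] by blast
  have inv: "Blinfun h o\<^sub>L f' x0 = id_blinfun"
    using h f'[OF assms(3)]
    by (intro blinfun_eqI) (simp add: bounded_linear_Blinfun_apply linear_conv_bounded_linear pointfree_idE)
  have derf': "\<And>x. x \<in> U \<Longrightarrow> (f has_derivative blinfun_apply (f' x)) (at x)"
    using deriv f' by simp
  obtain U' V g g' where *: "open U'" "U' \<subseteq> U" "x0 \<in> U'" "open V" "f x0 \<in> V"
      "homeomorphism U' V f g"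
      "\<And>y. y \<in> V \<Longrightarrow> (g has_derivative (g' y)) (at y)"
      "\<And>y. y \<in> V \<Longrightarrow> g' y = inv (blinfun_apply (f'(g y)))"
      "\<And>y. y \<in> V \<Longrightarrow> bij (blinfun_apply (f'(g y)))"
    by (rule inverse_function_theorem[OF assms(1) _ cont assms(3) inv])
      (rule derf', assumption, rule that)
  have gV: "g ` V = U'" "g ` V \<subseteq> U"
    using *(2,6) by (auto simp: homeomorphism_def)
  have bij: "bij (frechet_derivative f (at x))" if "x \<in> U'" for x
  proof -
    have "f x \<in> V" "g (f x) = x"
      using *(6) that by (auto simp: homeomorphism_def)
    then show ?thesis using *(9)[of "f x"] f'[of x] that *(2) by auto
  qed
  have "smooth_on V g"
    unfolding smooth_on_def
  proof
    fix k
    have "blinfun_apply (f' (g y)) = frechet_derivative f (at (g y))" if "y \<in> V" for y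
      using gV(2) that by (intro f') auto
    then show "Ck_on k V g"
      using *(8,9) by (intro Ck_on_inverse_function[OF assms(2) *(4) gV(2) *(7)]) simp_all
  qed
  moreover have "smooth_on U' f"
  proof -
    have "Ck_on k U' f" for k
      using Ck[of k] *(2)
    proof (induction k arbitrary: f)
      case 0
      then show ?case using continuous_on_subset by auto
    qed auto
    then show ?thesis by (simp add: smooth_on_def)
  qed
  ultimately have "diffeomorphism U' V f g"
    using * by (simp add: diffeomorphism_def)
  then show thesis
    using that[OF *(2,3)] bij by simp
qed

section \<open>Regular zero sets\<close>

text \<open>A linear right inverse \<open>R\<close> splits the space into the kernel and
  \<open>range R\<close>, by \<open>x = (x - R (D x)) + R (D x)\<close>, and \<open>range R\<close>
  has the dimension of the target.\<close>

lemma dim_kernel_surj: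
  fixes D :: "'a::euclidean_space \<Rightarrow> 'b::euclidean_space"
  assumes "linear D" "surj D"
  shows "dim {x. D x = 0} = DIM('a) - DIM('b)"
proof -
  obtain R where R: "linear R" "D \<circ> R = id"
    using linear_surjective_right_inverse[OF assms] by blast
  then have DR: "D (R y) = y" for y
    by (simp add: pointfree_idE)
  have "inj R"
    using DR by (metis injI)
  have sub: "subspace {x. D x = 0}" "subspace (range R)"
    using assms(1) R(1) by (auto simp: linear_subspace_kernel linear_subspace_image)
  have "{x + y |x y. x \<in> {x. D x = 0} \<and> y \<in> range R} = UNIV"
  proof safe
    fix x
    have "x = (x - R (D x)) + R (D x)" "D (x - R (D x)) = 0"
      by (simp_all add: linear_diff[OF assms(1)] DR)
    then show "\<exists>u v. x = u + v \<and> u \<in> {x. D x = 0} \<and> v \<in> range R"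
      by blast
  qed simp
  moreover have "{x. D x = 0} \<inter> range R = {0}"
    using DR linear_0[OF R(1)] linear_0[OF assms(1)] by force
  moreover have "dim (range R) = DIM('b)"
    using dim_image_eq[OF R(1), of UNIV] \<open>inj R\<close> by simp
  ultimately show ?thesis
    using dim_sums_Int[OF sub] by simp
qed

text \<open>A regular value theorem in which 0 need not be a regular value: singular zeros are
  simply left out. This does no harm locally, since all zeros near a regular one are
  regular.\<close>

theorem smooth_submanifold_regular_zeros:
  fixes G :: "real^'n \<Rightarrow> 'b::euclidean_space"
  assumes G: "smooth_on UNIV G"
  shows "smooth_submanifold (CARD('n) - DIM('b))
    {x. G x = 0 \<and> surj (frechet_derivative G (at x))}" (is "smooth_submanifold _ ?S")
  unfolding smooth_submanifold_def
proof
  fix x0 assume "x0 \<in> ?S"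
  define D where "D = frechet_derivative G (at x0)"
  have dG: "(G has_derivative frechet_derivative G (at x)) (at x)" for x
    using G Ck_on_Suc_has_derivative[of 0 UNIV G] by (simp add: smooth_on_def del: Ck_on.simps)
  have bD: "bounded_linear D"
    using dG has_derivative_bounded_linear by (auto simp: D_def)
  then have D: "linear D" "surj D"
    using \<open>x0 \<in> ?S\<close> by (auto simp: D_def linear_conv_bounded_linear)
  obtain R where R: "linear R" "D \<circ> R = id"
    using linear_surjective_right_inverse[OF D] by blast
  then have DR: "D (R y) = y" for y
    by (simp add: pointfree_idE)
  have bR: "bounded_linear R"
    using R by (simp add: linear_conv_bounded_linear)
  \<comment> \<open>The derivative of \<open>f\<close> at \<open>x0\<close> is the identity, and \<open>f\<close> turns the equation \<open>G = 0\<close> into \<open>D = 0\<close>.\<close>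
  define f where "f x = x + R (G x - D x)" for x
  have Df: "D (f x) = G x" for x
    by (simp add: f_def linear_add[OF D(1)] DR)
  have df: "frechet_derivative f (at x) = (\<lambda>v. v + R (frechet_derivative G (at x) v - D v))" for x
    unfolding f_def
    by (rule frechet_derivative_at[symmetric])
      (intro derivative_intros dG bounded_linear.has_derivative[OF bR] bounded_linear_imp_has_derivative bD)
  have "smooth_on UNIV f"
    unfolding smooth_on_def
  proof
    fix k
    have "Ck_on k UNIV G"
      using G by (simp add: smooth_on_def)
    moreover have "Ck_on k UNIV (\<lambda>x. - D x)"
      by (intro Ck_on_bounded_linear bounded_linear_minus bD) simp
    ultimately have "Ck_on k UNIV (\<lambda>x. x + R (G x + - D x))"
      by (intro Ck_on_add Ck_on_bounded_linear_comp[OF _ bR] Ck_on_bounded_linear[of _ "\<lambda>x. x"]) auto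
    then show "Ck_on k UNIV f"
      by (simp add: f_def[abs_def])
  qed
  moreover have "inj (frechet_derivative f (at x0))"
    using linear_0[OF R(1)] by (simp add: df D_def)
  ultimately obtain U V g where UV: "x0 \<in> U" "diffeomorphism U V f g"
      and bij: "\<And>x. x \<in> U \<Longrightarrow> bij (frechet_derivative f (at x))"
    using smooth_inverse_function[of UNIV f x0] by auto
  then have hom: "homeomorphism U V f g"
    by (simp add: diffeomorphism_def)
  \<comment> \<open>Since \<open>G\<close> is \<open>D\<close> after \<open>f\<close>, and the
    derivative of \<open>f\<close> is bijective on \<open>U\<close>, every zero of \<open>G\<close>
    in \<open>U\<close> belongs to the set in question.\<close>
  have "surj (frechet_derivative G (at x))" if "x \<in> U" for x
  proof -
    have "D (frechet_derivative f (at x) v) = frechet_derivative G (at x) v" for v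
      by (simp add: df linear_add[OF D(1)] DR)
    then have "frechet_derivative G (at x) = D \<circ> frechet_derivative f (at x)"
      by auto
    then show ?thesis
      using comp_surj[of "frechet_derivative f (at x)" D] bij[OF that] D(2) by (simp add: bij_is_surj)
  qed
  then have "f ` (?S \<inter> U) = {x. D x = 0} \<inter> V"
    using hom Df unfolding homeomorphism_def by (auto simp: image_iff)
  moreover have "dim {x. D x = 0} = CARD('n) - DIM('b)"
    using dim_kernel_surj[OF D] by simp
  ultimately show "\<exists>U V (f :: real^'n \<Rightarrow> real^'n) g W. x0 \<in> U \<and> diffeomorphism U V f g \<and> subspace W \<and>
      dim W = CARD('n) - DIM('b) \<and> f ` (?S \<inter> U) = W \<inter> V"
    using UV linear_subspace_kernel[OF D(1)] by (intro exI conjI)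
qed

section \<open>Forms of degree 6 and Bezout relations\<close>

text \<open>Iterated two-term Bezout: adding an element \<open>x\<close> replaces the combination
  found so far by its gcd with \<open>a x\<close>, which scales the old coefficients by
  \<open>s\<close> and gives \<open>x\<close> the coefficient \<open>t\<close>.\<close>

lemma exists_sum_dvd_family:
  fixes a :: "'i \<Rightarrow> 'a::euclidean_ring_gcd"
  assumes "finite A"
  shows "\<exists>u. \<forall>i\<in>A. (\<Sum>j\<in>A. u j * a j) dvd a i"
  using assms
proof (induction A)
  case (insert x A)
  then obtain u where u: "\<forall>i\<in>A. (\<Sum>j\<in>A. u j * a j) dvd a i" by blast
  obtain s t where st: "s * (\<Sum>j\<in>A. u j * a j) + t * a x = gcd (\<Sum>j\<in>A. u j * a j) (a x)"
    using bezout_coefficients_fst_snd by blast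
  define w where "w = (\<lambda>j. s * u j)(x := t)"
  have "(\<Sum>j\<in>insert x A. w j * a j) = t * a x + (\<Sum>j\<in>A. s * u j * a j)"
    using insert.hyps by (auto simp: w_def intro!: sum.cong)
  also have "\<dots> = gcd (\<Sum>j\<in>A. u j * a j) (a x)"
    by (simp add: st[symmetric] sum_distrib_left mult.assoc add.commute)
  finally show ?case
    using u by (intro exI[of _ w]) (auto intro: dvd_trans)
qed simp

lemma poly_map_poly_of_real_mult:
  fixes z :: "'a::{real_algebra_1,comm_ring_1}"
  shows "poly (map_poly of_real (p * q)) z = poly (map_poly of_real p) z * poly (map_poly of_real q) z"
proof -
  have add: "poly (map_poly of_real (p + q)) z = poly (map_poly of_real p) z + poly (map_poly of_real q) z" for p q
  proof -
    have "map_poly of_real (p + q) = map_poly of_real p + (map_poly of_real q :: 'a poly)"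
      by (intro poly_eqI) (simp add: coeff_map_poly)
    then show ?thesis by simp
  qed
  have smult: "poly (map_poly of_real (smult c p)) z = of_real c * poly (map_poly of_real p) z" for c p
  proof -
    have "map_poly of_real (smult c p) = smult (of_real c) (map_poly of_real p :: 'a poly)"
      by (intro poly_eqI) (simp add: coeff_map_poly)
    then show ?thesis by simp
  qed
  show ?thesis
    by (induction p) (simp_all add: map_poly_pCons add smult algebra_simps)
qed

lemma poly_map_poly_of_real_sum:
  fixes z :: "'a::{real_algebra_1,comm_ring_1}"
  shows "poly (map_poly of_real (\<Sum>i\<in>A. f i)) z = (\<Sum>i\<in>A. poly (map_poly of_real (f i)) z)"
proof -
  have "map_poly of_real (\<Sum>i\<in>A. f i) = (\<Sum>i\<in>A. map_poly of_real (f i) :: 'a poly)"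
    by (intro poly_eqI) (simp add: coeff_map_poly coeff_sum)
  then show ?thesis by (simp add: poly_sum)
qed

text \<open>A real combination \<open>g\<close> divides all \<open>a i\<close>, so a complex root of
  \<open>g\<close> would be a common root. By the fundamental theorem of algebra \<open>g\<close> is
  a nonzero constant, which is then scaled to 1.\<close>

lemma bezout_no_common_complex_root:
  fixes a :: "'i::finite \<Rightarrow> real poly"
  assumes "\<not> (\<exists>z :: complex. \<forall>i. poly (map_poly of_real (a i)) z = 0)"
  shows "\<exists>u. (\<Sum>i\<in>UNIV. u i * a i) = 1"
proof -
  obtain u where u: "(\<Sum>j\<in>UNIV. u j * a j) dvd a i" for i
    using exists_sum_dvd_family[of UNIV a] by auto
  define g where "g = (\<Sum>j\<in>UNIV. u j * a j)"
  have "poly (map_poly of_real g) z \<noteq> 0" for z :: complex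
  proof
    assume "poly (map_poly of_real g) z = 0"
    then have "poly (map_poly of_real (a i)) z = 0" for i
      using u[of i] by (auto simp: g_def[symmetric] poly_map_poly_of_real_mult)
    then show False using assms by blast
  qed
  then obtain c where "c \<noteq> 0" "map_poly of_real g = [:c :: complex:]"
    using fundamental_theorem_of_algebra_alt[of "map_poly of_real g"] by blast
  then have "degree g = 0" "g \<noteq> 0"
    using degree_map_poly[of "of_real :: real \<Rightarrow> complex" g] by auto
  then obtain d where d: "g = [:d:]" "d \<noteq> 0"
    by (metis degree_eq_zeroE pCons_0_0)
  have "(\<Sum>j\<in>UNIV. smult (inverse d) (u j) * a j) = smult (inverse d) g"
    by (intro poly_eqI) (simp add: g_def coeff_sum sum_distrib_left)
  also have "\<dots> = 1"
    using d by (simp add: one_pCons)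
  finally show ?thesis
    by (intro exI[of _ "\<lambda>j. smult (inverse d) (u j)"])
qed

section \<open>Index types, and forms as polynomials in one variable\<close>

text \<open>Ensures that different exponents \<open>j\<close> in \<open>sextic\<close> address
  different coefficients. Surjectivity is checked directly; injectivity follows by counting.\<close>

lemma bij_betw_of_nat_7: "bij_betw of_nat {..6} (UNIV :: 7 set)"
proof -
  have "\<exists>n\<le>6. x = of_nat n" for x :: 7
  proof (cases x)
    case (of_int z)
    then have "x = of_nat (nat z)" "nat z \<le> 6" by auto
    then show ?thesis by blast
  qed
  then have "of_nat ` {..6::nat} = (UNIV :: 7 set)" by auto
  then show ?thesis
    by (auto simp: bij_betw_def intro: eq_card_imp_inj_on)
qed

lemma bij_betw_of_nat_5: "bij_betw of_nat {..4} (UNIV :: 5 set)"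
proof -
  have "\<exists>n\<le>4. x = of_nat n" for x :: 5
  proof (cases x)
    case (of_int z)
    then have "x = of_nat (nat z)" "nat z \<le> 4" by auto
    then show ?thesis by blast
  qed
  then have "of_nat ` {..4::nat} = (UNIV :: 5 set)" by auto
  then show ?thesis
    by (auto simp: bij_betw_def intro: eq_card_imp_inj_on)
qed

lemma sum_UNIV_5: "(\<Sum>i\<in>UNIV. f i) = f 0 + f 1 + f 2 + f 3 + f (4 :: 5)"
proof -
  have "(\<Sum>i\<in>UNIV. f i) = (\<Sum>n\<le>4. f (of_nat n))"
    using sum.reindex_bij_betw[OF bij_betw_of_nat_5, of f] by simp
  then show ?thesis
    by (simp add: eval_nat_numeral add.assoc)
qed

text \<open>The dehomogenization \<open>t = 1\<close>, with \<open>s\<close> as variable. The degree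
  drops below 6 exactly when the form vanishes at the point \<open>(1, 0)\<close> at
  infinity.\<close>

definition form_poly :: "real^7 \<Rightarrow> real poly" where
  "form_poly c = (\<Sum>j\<le>6. monom (c $ of_nat j) j)"

lemma coeff_form_poly: "coeff (form_poly c) n = (if n \<le> 6 then c $ of_nat n else 0)"
  by (simp add: form_poly_def coeff_sum)

lemma degree_form_poly: "degree (form_poly c) \<le> 6"
  by (rule degree_le) (simp add: coeff_form_poly)

lemma form_poly_add: "form_poly (c + d) = form_poly c + form_poly d"
  by (intro poly_eqI) (simp add: coeff_form_poly)

lemma form_poly_scaleR: "form_poly (r *\<^sub>R c) = smult r (form_poly c)"
  by (intro poly_eqI) (simp add: coeff_form_poly)

lemma form_poly_surj:
  assumes "degree p \<le> 6"
  obtains c where "form_poly c = p"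
proof
  show "form_poly (\<chi> i. coeff p (inv_into {..6} of_nat i)) = p"
    using bij_betw_of_nat_7 assms
    by (intro poly_eqI) (auto simp: coeff_form_poly bij_betw_def coeff_eq_0)
qed

lemma sextic_dehomogenize: "sextic c z 1 = poly (map_poly of_real (form_poly c)) z"
proof -
  define P :: "'a poly" where "P = map_poly of_real (form_poly c)"
  have "degree P \<le> 6"
    by (rule degree_le) (simp add: P_def coeff_map_poly coeff_form_poly)
  then have "poly P z = (\<Sum>i\<le>6. coeff P i * z ^ i)"
    using poly_as_sum_of_monoms'[of P 6] by (metis (no_types, lifting) poly_monom poly_sum sum.cong)
  then show ?thesis
    by (simp add: sextic_def P_def coeff_map_poly coeff_form_poly)
qed

lemma sextic_dehomogenize_real: "sextic c z 1 = poly (form_poly c) z"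
  using sextic_dehomogenize[of c z] by (simp add: map_poly_idI of_real_def)

lemma sextic_homogeneous: "sextic c (a * s) (a * t) = a ^ 6 * sextic c s t"
proof -
  have "a ^ 6 = a ^ j * a ^ (6 - j)" if "j \<le> 6" for j
    using that by (simp flip: power_add)
  then show ?thesis
    unfolding sextic_def sum_distrib_left
    by (intro sum.cong) (auto simp: power_mult_distrib mult_ac)
qed

lemma sextic_infinity: "sextic c s 0 = of_real (c $ 6) * s ^ 6"
proof -
  have "sextic c s 0 = (\<Sum>j\<le>6::nat. if j = 6 then of_real (c $ 6) * s ^ 6 else 0)"
    unfolding sextic_def by (intro sum.cong) (auto simp: power_0_left)
  then show ?thesis by simp
qed

lemma sextic_eq_poly:
  fixes s t :: "'a::{real_algebra_1,field}"
  assumes "t \<noteq> 0"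
  shows "sextic c s t = t ^ 6 * poly (map_poly of_real (form_poly c)) (s / t)"
  using sextic_homogeneous[of c t "s / t" 1] assms by (simp add: sextic_dehomogenize)

section \<open>The polarized sphere equation\<close>

text \<open>The symmetric bilinear form of the quadric, of signature (4, 1), applied to
  dehomogenized forms. Polynomials of degree at most 12 stand for the forms of degree 12.\<close>

definition pairing :: "coeffs \<Rightarrow> coeffs \<Rightarrow> real poly" where
  "pairing p q = (\<Sum>i\<in>UNIV. smult (if i = 0 then - 1 else 1) (form_poly (p $ i) * form_poly (q $ i)))"

lemma pairing_commute: "pairing p q = pairing q p"
  by (simp add: pairing_def mult.commute)

lemma pairing_add_right: "pairing p (q + r) = pairing p q + pairing p r"
  by (simp add: pairing_def form_poly_add algebra_simps smult_add_right sum.distrib)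

lemma pairing_scaleR_right: "pairing p (c *\<^sub>R q) = smult c (pairing p q)"
  by (intro poly_eqI)
    (simp add: pairing_def form_poly_scaleR coeff_sum sum_distrib_left mult_ac)

lemma degree_pairing: "degree (pairing p q) \<le> 12"
  unfolding pairing_def
proof (intro degree_sum_le)
  fix i :: 5
  have "degree (form_poly (p $ i) * form_poly (q $ i)) \<le> 12"
    using degree_mult_le[of "form_poly (p $ i)" "form_poly (q $ i)"]
      degree_form_poly[of "p $ i"] degree_form_poly[of "q $ i"] by linarith
  then show "degree (smult (if i = 0 then - 1 else 1) (form_poly (p $ i) * form_poly (q $ i))) \<le> 12"
    by simp
qed simp

lemma coeff_form_poly_mult_12: "coeff (form_poly c * form_poly d) 12 = c $ 6 * d $ 6"
proof -
  \<comment> \<open>In the convolution \<open>i\<close> and \<open>12 - i\<close> are both at most 6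
    only for \<open>i = 6\<close>.\<close>
  have "coeff (form_poly c * form_poly d) 12 = (\<Sum>i\<le>12::nat. if i = 6 then c $ 6 * d $ 6 else 0)"
    unfolding coeff_mult by (intro sum.cong) (auto simp: coeff_form_poly)
  then show ?thesis by simp
qed

lemma poly_map_pairing:
  fixes z :: "'a::{real_algebra_1,comm_ring_1}"
  assumes "\<And>i. poly (map_poly of_real (form_poly (p $ i))) z = 0"
  shows "poly (map_poly of_real (pairing p q)) z = 0"
  \<comment> \<open>The sign is moved into the second factor, so that evaluation splits off the
    vanishing first factor.\<close>
  unfolding pairing_def poly_map_poly_of_real_sum mult_smult_right[symmetric] poly_map_poly_of_real_mult
  by (simp add: assms)

lemma numerals_5_neq_0: "(1::5) \<noteq> 0" "(2::5) \<noteq> 0" "(3::5) \<noteq> 0" "(4::5) \<noteq> 0"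
proof -
  have "of_nat n \<noteq> (0::5)" if "0 < n" "n \<le> 4" for n
    using inj_onD[OF bij_betw_imp_inj_on[OF bij_betw_of_nat_5], of n 0] that by auto
  from this[of 1] this[of 2] this[of 3] this[of 4]
  show "(1::5) \<noteq> 0" "(2::5) \<noteq> 0" "(3::5) \<noteq> 0" "(4::5) \<noteq> 0" by simp_all
qed

text \<open>By homogeneity it is enough to look at \<open>t = 1\<close>, where the expression
  \<open>N\<close> is the value of the polynomial, and at \<open>t = 0\<close>, where it is governed
  by the coefficient of index 12. Conversely, a real polynomial vanishing at all real points is
  zero.\<close>

lemma in_sphere_iff_pairing: "in_sphere p \<longleftrightarrow> pairing p p = 0"
proof -
  define N where "N s t = (sextic (p $ 1) s t)\<^sup>2 + (sextic (p $ 2) s t)\<^sup>2 + (sextic (p $ 3) s t)\<^sup>2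
       + (sextic (p $ 4) s t)\<^sup>2 - (sextic (p $ 0) s t)\<^sup>2" for s t :: real
  have affine: "N z 1 = poly (pairing p p) z" for z
    by (simp add: N_def pairing_def poly_sum sum_UNIV_5 numerals_5_neq_0 sextic_dehomogenize_real
        power2_eq_square)
  have infinity: "N s 0 = coeff (pairing p p) 12 * s ^ 12" for s
    by (simp add: N_def pairing_def coeff_sum sum_UNIV_5 numerals_5_neq_0 sextic_infinity
        coeff_form_poly_mult_12 power_mult_distrib power2_eq_square algebra_simps flip: power_add)
  have homog: "N (a * s) (a * t) = a ^ 12 * N s t" for a s t
    by (simp add: N_def sextic_homogeneous power_mult_distrib algebra_simps flip: power_mult)
  have "N s t = 0" if "pairing p p = 0" for s t
  proof (cases "t = 0")
    case True
    then show ?thesis using infinity that by simp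
  next
    case False
    then show ?thesis using homog[of t "s / t" 1] affine that by simp
  qed
  moreover have "pairing p p = 0" if "\<And>s t. N s t = 0"
    using that affine poly_all_0_iff_0 by metis
  ultimately show ?thesis
    unfolding in_sphere_def N_def by blast
qed

text \<open>The first conjunct says that \<open>(1, 0)\<close>, the point lost by dehomogenization, is not a common root.\<close>

lemma no_common_root_iff:
  "no_common_root p \<longleftrightarrow>
    (\<exists>i. p $ i $ 6 \<noteq> 0) \<and> \<not> (\<exists>z :: complex. \<forall>i. poly (map_poly of_real (form_poly (p $ i))) z = 0)"
proof -
  have "(\<exists>s t :: complex. (s, t) \<noteq> (0, 0) \<and> (\<forall>i. sextic (p $ i) s t = 0)) \<longleftrightarrow>
    (\<forall>i. p $ i $ 6 = 0) \<or> (\<exists>z :: complex. \<forall>i. poly (map_poly of_real (form_poly (p $ i))) z = 0)"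
    (is "?L \<longleftrightarrow> ?A \<or> ?B")
  proof
    assume ?L
    then obtain s t :: complex where st: "(s, t) \<noteq> (0, 0)" "\<And>i. sextic (p $ i) s t = 0" by blast
    show "?A \<or> ?B"
    proof (cases "t = 0")
      case True
      then show ?thesis using st by (auto simp: sextic_infinity)
    next
      case False
      then show ?thesis using st by (auto simp: sextic_eq_poly)
    qed
  next
    assume "?A \<or> ?B"
    then show ?L
    proof
      assume ?A
      then have "(1::complex, 0::complex) \<noteq> (0, 0) \<and> (\<forall>i. sextic (p $ i) 1 (0::complex) = 0)"
        by (simp add: sextic_infinity)
      then show ?L by blast
    next
      assume ?B
      then obtain z :: complex where "\<forall>i. poly (map_poly of_real (form_poly (p $ i))) z = 0" by blast
      then have "(z, 1::complex) \<noteq> (0, 0) \<and> (\<forall>i. sextic (p $ i) z 1 = 0)"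
        by (simp add: sextic_dehomogenize)
      then show ?L by blast
    qed
  qed
  then show ?thesis
    unfolding no_common_root_def by blast
qed

section \<open>Absence of common roots as surjectivity of the pairing\<close>

lemma pairing_surj:
  assumes "no_common_root p" "pairing p p = 0" "degree h \<le> 12"
  shows "\<exists>q. pairing p q = h"
proof -
  define a where "a i = form_poly (p $ i)" for i
  define \<epsilon> :: "5 \<Rightarrow> real" where "\<epsilon> i = (if i = 0 then - 1 else 1)" for i
  have split: "(\<Sum>i\<in>UNIV. f i) = f 0 + (\<Sum>i\<in>-{0}. f i)" for f :: "5 \<Rightarrow> 'x::comm_monoid_add"
    by (subst sum.remove[of _ 0]) (auto simp: Compl_eq_Diff_UNIV)
  \<comment> \<open>The coefficient of index 12 in the sphere equation equates the square of
    \<open>p $ 0 $ 6\<close> with a sum of real squares. If it were 0, all \<open>p $ i $ 6\<close>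
    would vanish and infinity would be a common root.\<close>
  have "p $ 0 $ 6 \<noteq> 0"
  proof
    assume "p $ 0 $ 6 = 0"
    moreover have "0 = (\<Sum>i\<in>UNIV. \<epsilon> i * (p $ i $ 6 * p $ i $ 6))"
      using arg_cong[OF assms(2), of "\<lambda>r. coeff r 12"]
      by (simp add: pairing_def coeff_sum coeff_form_poly_mult_12 \<epsilon>_def)
    ultimately have "(\<Sum>i\<in>-{0}. p $ i $ 6 * p $ i $ 6) = 0"
      by (simp add: split \<epsilon>_def)
    then have "p $ i $ 6 = 0" if "i \<noteq> 0" for i
      using that by (subst (asm) sum_nonneg_eq_0_iff) auto
    with \<open>p $ 0 $ 6 = 0\<close> show False
      using assms(1) unfolding no_common_root_iff by metis
  qed
  then have deg: "degree (a 0) = 6"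
    using degree_form_poly[of "p $ 0"] le_degree[of "a 0" 6]
    by (simp add: a_def coeff_form_poly)
  then have a0: "a 0 \<noteq> 0" by auto
  obtain u where u: "(\<Sum>i\<in>UNIV. u i * a i) = 1"
    using bezout_no_common_complex_root[of a] assms(1) by (auto simp: no_common_root_iff a_def)
  \<comment> \<open>Reducing the coefficients of a Bezout relation for \<open>h\<close> modulo \<open>a 0\<close>, which has exact degree 6,
    keeps all of them in degree at most 6.\<close>
  define v where "v i = (if i = 0 then h * u 0 + (\<Sum>j\<in>-{0}. (h * u j div a 0) * a j)
    else (h * u i) mod a 0)" for i
  \<comment> \<open>The quotient removed at index \<open>j\<close> is moved into the coefficient of
    \<open>a 0\<close>, leaving the total unchanged.\<close>
  have divmod: "(h * u j div a 0) * a j * a 0 + (h * u j mod a 0) * a j = h * (u j * a j)" for j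
  proof -
    have "(h * u j div a 0) * a j * a 0 + (h * u j mod a 0) * a j
      = ((h * u j div a 0) * a 0 + h * u j mod a 0) * a j"
      by (simp only: distrib_left distrib_right mult_ac)
    then show ?thesis by (simp add: mult.assoc)
  qed
  have "(\<Sum>i\<in>UNIV. v i * a i) = v 0 * a 0 + (\<Sum>j\<in>-{0}. (h * u j mod a 0) * a j)"
    by (simp add: split v_def)
  also have "\<dots> = h * (u 0 * a 0)
      + (\<Sum>j\<in>-{0}. (h * u j div a 0) * a j * a 0 + (h * u j mod a 0) * a j)"
    by (simp add: v_def distrib_right sum_distrib_right sum.distrib mult.assoc)
  also have "\<dots> = h * (\<Sum>i\<in>UNIV. u i * a i)"
    by (simp only: divmod split distrib_left sum_distrib_left)
  finally have v: "(\<Sum>i\<in>UNIV. v i * a i) = h"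
    using u by simp
  have deg_v: "degree (v i) \<le> 6" if "i \<noteq> 0" for i
    using degree_mod_less[OF a0, of "h * u i"] that deg by (auto simp: v_def)
  \<comment> \<open>\<open>v 0\<close> is not a remainder; its degree is read off from the relation
    itself, in which everything except \<open>v 0 * a 0\<close> has degree at most 12 while
    \<open>a 0\<close> has degree exactly 6.\<close>
  have "degree (v 0) \<le> 6"
  proof (cases "v 0 = 0")
    case False
    have "v 0 * a 0 = h - (\<Sum>i\<in>-{0}. v i * a i)"
      using v by (simp add: split algebra_simps)
    also have "degree \<dots> \<le> 12"
    proof (intro degree_diff_le assms(3) degree_sum_le)
      fix i :: 5 assume "i \<in> -{0}"
      then show "degree (v i * a i) \<le> 12"
        using degree_mult_le[of "v i" "a i"] deg_v[of i] degree_form_poly[of "p $ i"]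
        by (simp add: a_def)
    qed simp
    finally show ?thesis
      using degree_mult_eq[OF False a0] deg by simp
  qed simp
  \<comment> \<open>The factor \<open>\<epsilon> i\<close> cancels the sign built into
    \<open>pairing\<close>, since its square is 1.\<close>
  then have "degree (smult (\<epsilon> i) (v i)) \<le> 6" for i
    using deg_v[of i] by (cases "i = 0") (auto simp: \<epsilon>_def)
  then have "\<exists>c. form_poly c = smult (\<epsilon> i) (v i)" for i
    using form_poly_surj by metis
  then obtain q where q: "\<And>i. form_poly (q i) = smult (\<epsilon> i) (v i)" by metis
  have "pairing p (\<chi> i. q i) = (\<Sum>i\<in>UNIV. v i * a i)"
    unfolding pairing_def by (intro sum.cong) (auto simp: q a_def \<epsilon>_def mult_ac)
  then show ?thesis using v by blast
qed

text \<open>A common root of \<open>p\<close> is a root of every \<open>pairing p q\<close>. The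
  target \<open>monom 1 12\<close> does not vanish at infinity, and the target 1 vanishes at no
  finite point.\<close>

lemma no_common_root_if_pairing_surj:
  assumes "\<And>h. degree h \<le> 12 \<Longrightarrow> \<exists>q. pairing p q = h"
  shows "no_common_root p"
  unfolding no_common_root_iff
proof
  show "\<exists>i. p $ i $ 6 \<noteq> 0"
  proof (rule ccontr)
    assume "\<not> (\<exists>i. p $ i $ 6 \<noteq> 0)"
    then have "coeff (pairing p q) 12 = 0" for q
      by (simp add: pairing_def coeff_sum coeff_form_poly_mult_12)
    moreover obtain q where "pairing p q = monom 1 12"
      using assms[of "monom 1 12"] by (auto simp: degree_monom_le)
    ultimately show False by (metis coeff_monom zero_neq_one)
  qed
  obtain q where "pairing p q = 1"
    using assms[of 1] by auto
  then show "\<not> (\<exists>z :: complex. \<forall>i. poly (map_poly of_real (form_poly (p $ i))) z = 0)"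
    using poly_map_pairing[of p _ q] by (auto simp: map_poly_1)
qed

lemma no_common_root_scaleR:
  assumes "c \<noteq> 0"
  shows "no_common_root (c *\<^sub>R p) \<longleftrightarrow> no_common_root p"
proof -
  have "sextic (c *\<^sub>R v) s t = of_real c * sextic v s t" for v and s t :: complex
    by (simp add: sextic_def sum_distrib_left mult.assoc)
  then show ?thesis
    using assms by (simp add: no_common_root_def)
qed

lemma in_sphere_scaleR:
  assumes "c \<noteq> 0"
  shows "in_sphere (c *\<^sub>R p) \<longleftrightarrow> in_sphere p"
  using assms by (simp add: in_sphere_iff_pairing pairing_scaleR_right pairing_commute[of "c *\<^sub>R p"])

section \<open>Affine charts\<close>

text \<open>By dimension, the hyperplane \<open>range L\<close> and one vector outside it span the
  whole space.\<close>

lemma hyperplane_complement_decomposition: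
  fixes L :: "'m::euclidean_space \<Rightarrow> 'v::euclidean_space"
  assumes L: "linear L" "inj L" and DIM: "DIM('v) = DIM('m) + 1" and p: "p \<notin> range L"
  obtains c y where "q = c *\<^sub>R p + L y"
proof -
  have sub: "span (range L) = range L"
    using L(1) by (simp add: span_eq_iff linear_subspace_image)
  have "dim (range L) = DIM('m)"
    using dim_image_eq[OF L(1), of UNIV] L(2) by simp
  moreover have "p \<notin> span (range L)"
    using p unfolding sub .
  ultimately have "dim (insert p (range L)) = DIM('v)"
    using DIM by (simp add: dim_insert)
  then have "q \<in> span (insert p (range L))"
    using dim_eq_full by blast
  then obtain c where "q - c *\<^sub>R p \<in> range L"
    unfolding span_breakdown_eq sub by blast
  then obtain y where "q - c *\<^sub>R p = L y" by blast
  then have "q = c *\<^sub>R p + L y" by (simp add: algebra_simps)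
  then show thesis by (rule that)
qed

text \<open>The set is shown to consist of the regular zeros of the sphere equation \<open>G\<close>
  written in the chart. Its values have 13 coefficients, whence the dimension 34 - 13 = 21.\<close>

lemma smooth_submanifold_affine_slice:
  fixes L :: "real^34 \<Rightarrow> coeffs"
  assumes L: "linear L" "inj L" and a: "a \<notin> range L"
  shows "smooth_submanifold 21 {x. no_common_root (a + L x) \<and> in_sphere (a + L x)}"
proof -
  \<comment> \<open>\<open>idx\<close> labels the coordinates of \<open>real^13\<close> by the
    exponents 0 to 12, so that \<open>C\<close> identifies the polynomials of degree at most 12 with
    \<open>real^13\<close>.\<close>
  obtain idx where idx: "bij_betw idx (UNIV :: 13 set) {..12::nat}"
    using ex_bij_betw_finite_nat[of "UNIV :: 13 set"] by (auto simp: atLeast0LessThan lessThan_Suc_atMost numeral_eq_Suc)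
  define C :: "real poly \<Rightarrow> real^13" where "C h = (\<chi> k. coeff h (idx k))" for h
  have C_add: "C (g + h) = C g + C h" and C_smult: "C (smult c h) = c *\<^sub>R C h" for c g h
    by (simp_all add: C_def vec_eq_iff)
  have C_surj: "\<exists>h. degree h \<le> 12 \<and> C h = y" for y
  proof (intro exI conjI)
    let ?h = "\<Sum>k\<in>UNIV. monom (y $ k) (idx k)"
    have "idx k \<le> 12" for k
      using idx by (auto simp: bij_betw_def)
    then show "degree ?h \<le> 12"
      by (intro degree_sum_le) (auto intro: order_trans[OF degree_monom_le])
    have "idx i = idx k \<longleftrightarrow> i = k" for i k
      using idx by (auto simp: bij_betw_def inj_on_def)
    then show "C ?h = y"
      by (simp add: C_def vec_eq_iff coeff_sum)
  qed
  have C_inj: "g = h" if "C g = C h" "degree g \<le> 12" "degree h \<le> 12" for g h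
  proof (rule poly_eqI)
    fix n
    show "coeff g n = coeff h n"
    proof (cases "n \<le> 12")
      case True
      then obtain k where "n = idx k"
        using idx by (auto simp: bij_betw_def image_iff dest: equalityD2[THEN subsetD])
      then show ?thesis using that(1) by (simp add: C_def vec_eq_iff)
    next
      case False
      then show ?thesis using that(2,3) by (simp add: coeff_eq_0)
    qed
  qed
  define B where "B p q = C (pairing p q)" for p q
  have "linear (B p)" for p
    by (rule linearI) (simp_all add: B_def C_add C_smult pairing_add_right pairing_scaleR_right)
  moreover have B_commute: "B p q = B q p" for p q
    by (simp add: B_def pairing_commute)
  ultimately have "bilinear B"
    by (simp add: bilinear_def)
  then have bB: "bounded_bilinear B"
    by (simp add: bilinear_conv_bounded_bilinear)
  have bL: "bounded_linear L"
    using L(1) by (simp add: linear_conv_bounded_linear)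
  define P where "P x = a + L x" for x
  define G where "G x = B (P x) (P x)" for x
  have "Ck_on k UNIV P" for k
    unfolding P_def[abs_def]
    by (intro Ck_on_add Ck_on_const Ck_on_bounded_linear bL) auto
  then have "smooth_on UNIV G"
    unfolding smooth_on_def G_def[abs_def]
    by (intro allI bounded_bilinear.Ck_on_bilinear[OF bB]) auto
  then have "smooth_submanifold 21 {x. G x = 0 \<and> surj (frechet_derivative G (at x))}"
    using smooth_submanifold_regular_zeros[of G] by simp
  moreover have "G x = 0 \<and> surj (frechet_derivative G (at x)) \<longleftrightarrow>
    no_common_root (P x) \<and> in_sphere (P x)" for x
  proof -
    have G0: "in_sphere (P x) \<longleftrightarrow> G x = 0"
      unfolding in_sphere_iff_pairing using C_inj[of "pairing (P x) (P x)" 0] degree_pairing by (auto simp: G_def B_def C_def vec_eq_iff)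
    have dP: "(P has_derivative L) (at x)"
      unfolding P_def[abs_def]
      using has_derivative_add[OF has_derivative_const bounded_linear_imp_has_derivative[OF bL]]
      by simp
    have "(G has_derivative (\<lambda>v. B (P x) (L v) + B (L v) (P x))) (at x)"
      unfolding G_def[abs_def] by (rule bounded_bilinear.FDERIV[OF bB dP dP])
    then have "frechet_derivative G (at x) = (\<lambda>v. B (P x) (L v) + B (L v) (P x))"
      by (rule frechet_derivative_at[symmetric])
    then have dG: "frechet_derivative G (at x) = (\<lambda>v. 2 *\<^sub>R B (P x) (L v))"
      by (simp add: B_commute[of "L _"] scaleR_2)
    show ?thesis
    proof (intro iffI conjI)
      assume *: "G x = 0 \<and> surj (frechet_derivative G (at x))"
      then show "in_sphere (P x)"
        unfolding G0 by (rule conjunct1)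
      have surj: "surj (\<lambda>v. 2 *\<^sub>R B (P x) (L v))"
        unfolding dG[symmetric] using * by (rule conjunct2)
      show "no_common_root (P x)"
      proof (rule no_common_root_if_pairing_surj)
        fix h :: "real poly" assume deg: "degree h \<le> 12"
        obtain v where "C h = 2 *\<^sub>R B (P x) (L v)"
          using surjD[OF surj] by blast
        then have "C (pairing (P x) (2 *\<^sub>R L v)) = C h"
          by (simp add: B_def pairing_scaleR_right C_smult)
        then show "\<exists>q. pairing (P x) q = h"
          using C_inj[OF _ degree_pairing deg] by blast
      qed
    next
      assume *: "no_common_root (P x) \<and> in_sphere (P x)"
      then have ncr: "no_common_root (P x)" and sphere: "pairing (P x) (P x) = 0"
        by (simp_all add: in_sphere_iff_pairing)
      show "G x = 0"
        unfolding G0[symmetric] using * by (rule conjunct2)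
      \<comment> \<open>The affine hyperplane \<open>a + range L\<close> misses the parallel linear
        one, so the tangent directions \<open>L v\<close> together with \<open>P x\<close> span all
        tuples.\<close>
      have "P x \<notin> range L"
      proof
        assume "P x \<in> range L"
        then obtain y where "a + L x = L y" by (auto simp: P_def)
        then have "a = L (y - x)" by (simp add: linear_diff[OF L(1)] eq_diff_eq)
        then show False using a by blast
      qed
      have "\<exists>v. y = 2 *\<^sub>R B (P x) (L v)" for y
      proof -
        \<comment> \<open>The half compensates the factor 2 in the derivative of the quadratic
          map.\<close>
        obtain h where h: "degree h \<le> 12" "C h = (1/2) *\<^sub>R y"
          using C_surj by blast
        obtain q where q: "pairing (P x) q = h"
          using pairing_surj[OF ncr sphere h(1)] by blast
        obtain c v where "q = c *\<^sub>R P x + L v"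
          by (rule hyperplane_complement_decomposition[OF L _ \<open>P x \<notin> range L\<close>]) simp_all
        \<comment> \<open>The component of \<open>q\<close> along \<open>P x\<close> contributes
          nothing because \<open>pairing (P x) (P x) = 0\<close>.\<close>
        then have "B (P x) (L v) = C h"
          using q sphere by (simp add: B_def pairing_add_right pairing_scaleR_right)
        then show ?thesis using h(2) by (intro exI[of _ v]) simp
      qed
      then show "surj (frechet_derivative G (at x))"
        unfolding dG surj_def by blast
    qed
  qed
  ultimately show ?thesis
    by (simp add: P_def)
qed

section \<open>Projective classes and the covering by charts\<close>

lemma proj_class_eqD:
  assumes "proj_class p = proj_class q"
  obtains c where "c \<noteq> 0" "q = c *\<^sub>R p"
proof -
  have "q \<in> proj_class q"
    unfolding proj_class_def by (rule CollectI, rule exI[of _ 1]) simp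
  then have "q \<in> proj_class p"
    by (simp only: assms)
  then obtain c where "q = c *\<^sub>R p" "c \<noteq> 0"
    unfolding proj_class_def by auto
  then show thesis
    by (intro that)
qed

text \<open>Both conditions are invariant under nonzero scaling, so they can be tested on any
  representative.\<close>

lemma proj_class_mem_sphere_parametrizations:
  "proj_class p \<in> sphere_parametrizations \<longleftrightarrow> no_common_root p \<and> in_sphere p"
proof
  assume "proj_class p \<in> sphere_parametrizations"
  then obtain q where q: "proj_class p = proj_class q" "no_common_root q" "in_sphere q"
    unfolding sphere_parametrizations_def by blast
  obtain c where "c \<noteq> 0" "q = c *\<^sub>R p"
    using proj_class_eqD[OF q(1)] .
  then show "no_common_root p \<and> in_sphere p"
    using q by (simp add: no_common_root_scaleR in_sphere_scaleR)
qed (auto simp: sphere_parametrizations_def)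

lemma proj_space_eq_Union_affine_charts:
  assumes DIM: "DIM('v::euclidean_space) = DIM('m::euclidean_space) + 1"
  shows "(proj_space :: 'v set set) = (\<Union>\<psi> \<in> affine_charts :: ('m \<Rightarrow> 'v set) set. range \<psi>)"
proof safe
  fix X :: "'v set" assume "X \<in> proj_space"
  then obtain v where v: "v \<noteq> 0" "X = proj_class v"
    unfolding proj_space_def by blast
  \<comment> \<open>The class of \<open>v\<close> is the center of the chart whose hyperplane at
    infinity is the orthogonal complement of \<open>v\<close>.\<close>
  have "dim {x. v \<bullet> x = 0} = dim (UNIV :: 'm set)"
    using dim_hyperplane[OF v(1)] DIM by simp
  then obtain L :: "'m \<Rightarrow> 'v" where L: "linear L" "range L = {x. v \<bullet> x = 0}" "inj L"
    using subspace_isomorphism[of "UNIV :: 'm set" "{x. v \<bullet> x = 0}"] subspace_hyperplane[of v] by auto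
  then have "v \<notin> range L"
    using v(1) by simp
  then have "(\<lambda>x. proj_class (v + L x)) \<in> affine_charts"
    unfolding affine_charts_def using L by blast
  moreover have "X = (\<lambda>x. proj_class (v + L x)) 0"
    using v(2) linear_0[OF L(1)] by simp
  ultimately show "X \<in> (\<Union>\<psi> \<in> affine_charts :: ('m \<Rightarrow> 'v set) set. range \<psi>)"
    by (metis UN_I rangeI)
next
  fix \<psi> :: "'m \<Rightarrow> 'v set" and x assume "\<psi> \<in> affine_charts"
  then obtain a L where L: "\<psi> = (\<lambda>x. proj_class (a + L x))" "linear L" "a \<notin> range L"
    unfolding affine_charts_def by blast
  have "a + L x \<noteq> 0"
  proof
    assume "a + L x = 0"
    then have "a = L (- x)"
      by (simp add: linear_neg[OF L(2)] eq_neg_iff_add_eq_0)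
    then show False using L(3) by blast
  qed
  then show "\<psi> x \<in> proj_space"
    unfolding proj_space_def L(1) by blast
qed

theorem theorem32:
  "submanifold_in (affine_charts :: (real^34 \<Rightarrow> coeffs set) set) proj_space
     21 sphere_parametrizations"
  unfolding submanifold_in_def
proof (intro conjI ballI)
  show "(proj_space :: coeffs set set) = (\<Union>\<psi>\<in>affine_charts :: (real^34 \<Rightarrow> coeffs set) set. range \<psi>)"
    by (rule proj_space_eq_Union_affine_charts) simp
  \<comment> \<open>For the zero tuple every point is a common root, in particular the one at
    infinity.\<close>
  have "p \<noteq> 0" if "no_common_root p" for p
    using that by (auto simp: no_common_root_iff)
  then show "sphere_parametrizations \<subseteq> proj_space"
    by (auto simp: sphere_parametrizations_def proj_space_def)
next
  fix \<psi> :: "real^34 \<Rightarrow> coeffs set" assume "\<psi> \<in> affine_charts"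
  then obtain a L where "\<psi> = (\<lambda>x. proj_class (a + L x))" "linear L" "inj L" "a \<notin> range L"
    unfolding affine_charts_def by blast
  then show "smooth_submanifold 21 (\<psi> -` sphere_parametrizations)"
    using smooth_submanifold_affine_slice[of L a]
    by (simp add: vimage_def proj_class_mem_sphere_parametrizations)
qed

end
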